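(* If $\mu$ is an even isotropic measure on $S^1$, $\varepsilon\in(0,1)$, and $\delta_{HO}({\rm supp}\,\mu,{\rm supp}\,\nu_2)\ge\varepsilon$, then $$V(Z_\infty(\mu))\ge(1+0.25\,\varepsilon)\,V(Z_\infty(\nu_2)),\qquad V(Z_\infty^*(\mu))\le(1-0.1\,\varepsilon)\,V(Z_\infty^*(\nu_2)).$$
   Context: $S^1$ is the Euclidean unit circle in $\mathbb{R}^2$, $\langle\cdot,\cdot\rangle$ the Euclidean scalar product, $V$ area. A Borel measure $\mu$ on $S^1$ is isotropic if $\int_{S^1}u\otimes u\,d\mu(u)={\rm Id}_2$; it is even if invariant under $u\mapsto-u$. $Z_\infty(\mu)={\rm conv}\,{\rm supp}\,\mu$ and $Z_\infty^*(\mu)=\{x\in\mathbb{R}^2:\langle x,u\rangle\le1\text{ for all }u\in{\rm supp}\,\mu\}$. $\nu_2$ is a fixed cross measure on $S^1$: there is an orthonormal basis $u_1,u_2$ of $\mathbb{R}^2$ with ${\rm supp}\,\nu_2=\{\pm u_1,\pm u_2\}$ and each of these four points has measure $1/2$. $\angle(x,y)$ denotes the angle between $x$ and $y$. For compact $X,Y\subseteq S^1$, the spherical Hausdorff distance is $$\delta_H(X,Y)=\max\left\{\max_{x\in X}\min_{y\in Y}\angle(x,y),\ \max_{y\in Y}\min_{x\in X}\angle(x,y)\right\},$$ and $\delta_{HO}(X,Y)=\min\{\delta_H(X,\Phi Y):\Phi\in{\rm O}(2)\}$. *)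

theory Defs
  imports "HOL-Analysis.Analysis"
begin

(* A Borel measure on the unit circle lives on the trace Borel algebra, so that
   space \<mu> = sphere 0 1. Finiteness is not required: for isotropic measures it
   follows from integrability of u \<otimes> u, whose trace is 1 on the circle. *)
definition circle_measure :: "(real^2) measure \<Rightarrow> bool" where
  "circle_measure \<mu> \<longleftrightarrow> sets \<mu> = sets (restrict_space borel (sphere 0 1))"

definition tensor_square :: "real^2 \<Rightarrow> real^2^2" where
  "tensor_square u = (\<chi> i j. u $ i * u $ j)"

definition isotropic :: "(real^2) measure \<Rightarrow> bool" where
  "isotropic \<mu> \<longleftrightarrow> has_bochner_integral \<mu> tensor_square (mat 1)"

definition even_measure :: "(real^2) measure \<Rightarrow> bool" where
  "even_measure \<mu> \<longleftrightarrow> (\<forall>A\<in>sets \<mu>. emeasure \<mu> (uminus ` A) = emeasure \<mu> A)"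

definition supp :: "'a::topological_space measure \<Rightarrow> 'a set" where
  "supp \<mu> = {x \<in> space \<mu>. \<forall>U. open U \<and> x \<in> U \<longrightarrow> emeasure \<mu> (U \<inter> space \<mu>) > 0}"

definition Z_inf :: "(real^2) measure \<Rightarrow> (real^2) set" where
  "Z_inf \<mu> = convex hull (supp \<mu>)"

definition Z_inf_polar :: "(real^2) measure \<Rightarrow> (real^2) set" where
  "Z_inf_polar \<mu> = {x. \<forall>u\<in>supp \<mu>. x \<bullet> u \<le> 1}"

definition cross_measure :: "(real^2) measure \<Rightarrow> bool" where
  "cross_measure \<nu> \<longleftrightarrow> circle_measure \<nu> \<and>
     (\<exists>u1 u2. norm u1 = 1 \<and> norm u2 = 1 \<and> u1 \<bullet> u2 = 0 \<and>
        supp \<nu> = {u1, - u1, u2, - u2} \<and>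
        (\<forall>v\<in>{u1, - u1, u2, - u2}. emeasure \<nu> {v} = 1 / 2))"

definition angle :: "real^2 \<Rightarrow> real^2 \<Rightarrow> real" where
  "angle x y = arccos (x \<bullet> y / (norm x * norm y))"

(* For nonempty compact subsets of the circle the suprema and infima are attained,
   as is the infimum over the compact group O(2) below, so they are the maxima and
   minima of the usual definitions. *)
definition spherical_hausdorff :: "(real^2) set \<Rightarrow> (real^2) set \<Rightarrow> real" where
  "spherical_hausdorff X Y =
     max (SUP x\<in>X. INF y\<in>Y. angle x y) (SUP y\<in>Y. INF x\<in>X. angle x y)"

definition spherical_hausdorff_O :: "(real^2) set \<Rightarrow> (real^2) set \<Rightarrow> real" where
  "spherical_hausdorff_O X Y =
     (INF \<Phi>\<in>{\<Phi>. orthogonal_transformation \<Phi>}. spherical_hausdorff X (\<Phi> ` Y))"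

end

theory Submission
  imports Defs
begin

text \<open>
  Integrating the identity of matrices that defines isotropy against a pair of orthogonal vectors shows
  that the symmetric support \<open>S\<close> of \<open>\<mu>\<close> cannot leave a gap larger than a right angle
  (\<open>supp_next_point\<close>).

  Being far from a cross is used for the cross through a point of \<open>S\<close>. If the distance exceeds \<open>e\<close>, then
  \<open>S\<close> contains two points whose angle \<open>a\<close> satisfies \<open>e \<le> a \<le> \<pi>/2 - e\<close> (\<open>far_from_crosses\<close>). Since the
  gaps of \<open>S\<close> are at most right angles, this angle can be completed to a half turn by at most three
  further gaps \<open>x\<close>, \<open>y\<close>, \<open>z\<close> between points of \<open>S\<close>, each of them at most a right angle
  (\<open>three_more_gaps\<close>; a gap may be zero).

  With their antipodes these points form a polygon inscribed in the circle, at most an octagon. Its area is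
  \<open>sin a + sin x + sin y + sin z\<close>, and it lies in the convex hull of \<open>S\<close>; the polygon
  circumscribed at the same points has area \<open>2 (tan (a/2) + tan (x/2) + tan (y/2) + tan (z/2))\<close>, and it
  contains the polar body (\<open>sum_sin_le_measure\<close>, \<open>measure_circumscribed_le\<close>).

  Both sums are controlled by convexity of \<open>- sin\<close> and of \<open>tan (g/2)\<close> on \<open>[0, \<pi>/2]\<close>: the worst gaps are
  \<open>(a, \<pi>/2 - a, \<pi>/2, 0)\<close>, with \<open>a\<close> moved to \<open>e\<close>. There one has to check
  \<open>sin e + cos e \<ge> 1 + e/2\<close> and \<open>tan (e/2) + tan (\<pi>/4 - e/2) \<le> 1 - e/5\<close> for \<open>0 \<le> e \<le> \<pi>/4\<close>. Both
  sides agree at \<open>e = 0\<close>, which is the case of the cross itself, and the inequalities follow by comparison with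
  the chord from \<open>0\<close> to \<open>\<pi>/4\<close> (\<open>sum_sin_gaps_ge\<close>, \<open>sum_tan_half_gaps_le\<close>).
  Since the cross has areas \<open>2\<close> and \<open>4\<close>, these are the claimed bounds.
\<close>

section \<open>Convexity in one variable\<close>

text \<open>
  Because the sums agree, \<open>x\<close> and \<open>y\<close> are convex combinations of \<open>u\<close> and \<open>v\<close> with exchanged
  weights, and the two convexity inequalities add up to the claim.
\<close>
lemma convex_on_spread:
  fixes f :: "real \<Rightarrow> real"
  assumes f: "convex_on A f" and A: "u \<in> A" "v \<in> A"
    and xy: "u \<le> x" "x \<le> v" "x + y = u + v"
  shows "f x + f y \<le> f u + f v"
proof (cases "u = v")
  case True
  then have "x = u" "y = v" using xy by auto
  then show ?thesis by simp
next
  case False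
  then have uv: "u < v" using xy by simp
  define k where "k = (x - u) / (v - u)"
  have k: "0 \<le> k" "k \<le> 1" using xy uv by (auto simp: k_def field_simps)
  have kx: "k * (v - u) = x - u" using uv by (simp add: k_def)
  have "f ((1 - k) *\<^sub>R u + k *\<^sub>R v) \<le> (1 - k) * f u + k * f v"
    by (rule convex_onD[OF f]) (use k A in auto)
  moreover have "f ((1 - (1 - k)) *\<^sub>R u + (1 - k) *\<^sub>R v) \<le> (1 - (1 - k)) * f u + (1 - k) * f v"
    by (rule convex_onD[OF f]) (use k A in auto)
  moreover have "(1 - k) *\<^sub>R u + k *\<^sub>R v = x" "(1 - (1 - k)) *\<^sub>R u + (1 - k) *\<^sub>R v = y"
    using kx xy by (auto simp: algebra_simps)
  ultimately show ?thesis by (simp add: algebra_simps)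
qed

text \<open>
  Among triples in \<open>[0, m]\<close> with a fixed sum, the most spread-out one is \<open>(m, b, 0)\<close>.
  It is reached by spreading two pairs in turn; which pair first
  hits the boundary decides the case. In the application \<open>m\<close> is a right angle and the triple consists of
  the gaps that complete a given gap to a half turn.
\<close>
lemma convex_sum_three_le:
  fixes f :: "real \<Rightarrow> real"
  assumes f: "convex_on {0..m} f" and b: "0 \<le> b" "b \<le> m"
    and g: "x \<in> {0..m}" "y \<in> {0..m}" "z \<in> {0..m}" "x + y + z = m + b"
  shows "f x + f y + f z \<le> f m + f b + f 0"
proof (cases "x + y \<le> m")
  case True
  have "f x + f y \<le> f 0 + f (x + y)"
    by (rule convex_on_spread[OF f]) (use g True in auto)
  moreover have "f (x + y) + f z \<le> f b + f m"
    by (rule convex_on_spread[OF f]) (use g True b in auto)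
  ultimately show ?thesis by simp
next
  case False
  have "f x + f y \<le> f (x + y - m) + f m"
    by (rule convex_on_spread[OF f]) (use g False b in auto)
  moreover have "f (x + y - m) + f z \<le> f 0 + f b"
    by (rule convex_on_spread[OF f]) (use g False b in auto)
  ultimately show ?thesis by simp
qed

text \<open>
  The distance of \<open>a\<close> from \<open>0\<close> and \<open>m\<close> is at least \<open>e\<close>, so spreading gives the pair \<open>(e, m - e)\<close>,
  and both arguments then lie on chords that end at the midpoint \<open>m / 2\<close>. This turns an inequality that is
  transcendental in \<open>e\<close> into one that is affine in \<open>e\<close>.
\<close>
lemma convex_sum_complementary_le:
  fixes f :: "real \<Rightarrow> real"
  assumes f: "convex_on {0..m} f" and m: "0 < m" and e: "0 \<le> e" "e \<le> a" "a \<le> m - e"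
  shows "f a + f (m - a) \<le> (1 - 2 * e / m) * (f 0 + f m) + (2 * e / m) * (2 * f (m / 2))"
proof -
  define k where "k = 2 * e / m"
  have k: "0 \<le> k" "k \<le> 1" using e m by (auto simp: k_def field_simps)
  have ke: "k * m = 2 * e" using m by (simp add: k_def)
  have "f a + f (m - a) \<le> f e + f (m - e)"
    by (rule convex_on_spread[OF f]) (use e m in auto)
  moreover have "f ((1 - k) *\<^sub>R 0 + k *\<^sub>R (m / 2)) \<le> (1 - k) * f 0 + k * f (m / 2)"
    by (rule convex_onD[OF f]) (use k m in auto)
  moreover have "f ((1 - k) *\<^sub>R m + k *\<^sub>R (m / 2)) \<le> (1 - k) * f m + k * f (m / 2)"
    by (rule convex_onD[OF f]) (use k m in auto)
  moreover have "(1 - k) *\<^sub>R 0 + k *\<^sub>R (m / 2) = e" "(1 - k) *\<^sub>R m + k *\<^sub>R (m / 2) = m - e"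
    using ke by (auto simp: algebra_simps)
  ultimately show ?thesis unfolding k_def[symmetric] by (simp add: algebra_simps)
qed

lemma convex_on_minus_sin: "convex_on {0..pi/2} (\<lambda>x. - sin x)"
proof (rule convex_on_realI)
  show "((\<lambda>x. - sin x) has_real_derivative - cos x) (at x)" for x :: real
    by (auto intro!: derivative_eq_intros)
  show "- cos x \<le> - cos y" if "x \<in> {0..pi/2}" "y \<in> {0..pi/2}" "x \<le> y" for x y :: real
    using that cos_monotone_0_pi_le[of x y] by simp
qed simp

text \<open>
  The function is \<open>tan (x / 2)\<close>; in this form its derivative is \<open>1 / (1 + cos x)\<close>, which is visibly
  increasing.
\<close>
lemma convex_on_tan_half: "convex_on {0..pi/2} (\<lambda>x. sin x / (1 + cos x))"
proof (rule convex_on_realI)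
  fix x :: real assume x: "x \<in> {0..pi/2}"
  have "0 \<le> cos x" using x by (intro cos_ge_zero) auto
  then have c: "1 + cos x \<noteq> 0" by simp
  have num: "cos x * (1 + cos x) + sin x * sin x = 1 + cos x"
    using sin_cos_squared_add[of x] by (simp add: power2_eq_square algebra_simps)
  have "((\<lambda>x. sin x / (1 + cos x)) has_real_derivative
      (cos x * (1 + cos x) + sin x * sin x) / ((1 + cos x) * (1 + cos x))) (at x)"
    using c by (auto intro!: derivative_eq_intros)
  then show "((\<lambda>x. sin x / (1 + cos x)) has_real_derivative 1 / (1 + cos x)) (at x)"
    unfolding num using c by simp
next
  fix x y :: real assume x: "x \<in> {0..pi/2}" "y \<in> {0..pi/2}" "x \<le> y"
  have "0 \<le> cos x" "0 \<le> cos y" using x by (auto intro!: cos_ge_zero)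
  then show "1 / (1 + cos x) \<le> 1 / (1 + cos y)"
    using x cos_monotone_0_pi_le[of x y] by (intro divide_left_mono) auto
qed simp

text \<open>
  The extremal gaps are \<open>(a, \<pi>/2 - a, \<pi>/2, 0)\<close>. The chord bound leaves the slope
  \<open>4 (\<surd>2 - 1) / \<pi>\<close> in \<open>e\<close>, about \<open>0.527\<close>,
  which is rounded down to \<open>1/2\<close>.
\<close>
lemma sum_sin_gaps_ge:
  assumes e: "0 \<le> e" "e \<le> a" "a \<le> pi/2 - e"
    and g: "x \<in> {0..pi/2}" "y \<in> {0..pi/2}" "z \<in> {0..pi/2}" "a + x + y + z = pi"
  shows "sin a + sin x + sin y + sin z \<ge> 2 + e / 2"
proof -
  have "- sin x + - sin y + - sin z \<le> - sin (pi/2) + - sin (pi/2 - a) + - sin 0"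
    by (rule convex_sum_three_le[OF convex_on_minus_sin]) (use e g in auto)
  then have "sin x + sin y + sin z \<ge> 1 + sin (pi/2 - a)" by simp
  moreover have "- sin a + - sin (pi/2 - a) \<le> (1 - 2 * e / (pi/2)) * (- sin 0 + - sin (pi/2))
      + (2 * e / (pi/2)) * (2 * - sin (pi/2/2))"
    by (rule convex_sum_complementary_le[OF convex_on_minus_sin]) (use e in auto)
  then have "sin a + sin (pi/2 - a) \<ge> 1 + e * (4 * (sqrt 2 - 1) / pi)"
    by (simp add: sin_45 algebra_simps diff_divide_distrib)
  ultimately have "sin a + sin x + sin y + sin z \<ge> 2 + e * (4 * (sqrt 2 - 1) / pi)"
    by linarith
  moreover have "1 / 2 \<le> 4 * (sqrt 2 - 1) / pi"
  proof -
    have "1.4 \<le> sqrt 2" by (rule real_le_rsqrt) (simp add: power2_eq_square)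
    then show ?thesis using pi_gt_zero pi_approx by (simp add: field_simps)
  qed
  then have "e * (1 / 2) \<le> e * (4 * (sqrt 2 - 1) / pi)" using e by (intro mult_left_mono)
  ultimately show ?thesis by linarith
qed

text \<open>
  The extremal gaps are the same as for the sine; here the chord bound leaves the slope
  \<open>4 (3 - 2 \<surd>2) / \<pi>\<close> in \<open>e\<close>, about \<open>0.218\<close>,
  which is rounded down to \<open>1/5\<close>.
\<close>
lemma sum_tan_half_gaps_le:
  fixes f :: "real \<Rightarrow> real"
  defines "f \<equiv> \<lambda>x. sin x / (1 + cos x)"
  assumes e: "0 \<le> e" "e \<le> a" "a \<le> pi/2 - e"
    and g: "x \<in> {0..pi/2}" "y \<in> {0..pi/2}" "z \<in> {0..pi/2}" "a + x + y + z = pi"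
  shows "f a + f x + f y + f z \<le> 2 - e / 5"
proof -
  have f: "convex_on {0..pi/2} f" unfolding f_def by (rule convex_on_tan_half)
  have f_val: "f 0 = 0" "f (pi/2) = 1" "f (pi/2/2) = sqrt 2 - 1"
  proof -
    have "sqrt 2 / 2 = (sqrt 2 - 1) * (1 + sqrt 2 / 2)" by
      (simp add: algebra_simps add_divide_distrib diff_divide_distrib)
    moreover have "1 + sqrt 2 / 2 \<noteq> 0" using real_sqrt_ge_zero[of 2] by linarith
    ultimately have "sqrt 2 / 2 / (1 + sqrt 2 / 2) = sqrt 2 - 1"
      by (subst nonzero_divide_eq_eq)
    then show "f (pi/2/2) = sqrt 2 - 1"
      by (simp only: f_def sin_45 cos_45 divide_divide_eq_left) (simp add: sin_45 cos_45)
  qed (simp_all add: f_def)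
  have "f x + f y + f z \<le> f (pi/2) + f (pi/2 - a) + f 0"
    by (rule convex_sum_three_le[OF f]) (use e g in auto)
  moreover have "f a + f (pi/2 - a) \<le> (1 - 2 * e / (pi/2)) * (f 0 + f (pi/2))
      + (2 * e / (pi/2)) * (2 * f (pi/2/2))"
    by (rule convex_sum_complementary_le[OF f]) (use e in auto)
  then have "f a + f (pi/2 - a) \<le> 1 - e * (4 * (3 - 2 * sqrt 2) / pi)"
    unfolding f_val by (simp add: algebra_simps diff_divide_distrib)
  ultimately have "f a + f x + f y + f z \<le> 2 - e * (4 * (3 - 2 * sqrt 2) / pi)"
    unfolding f_val by linarith
  moreover have "1 / 5 \<le> 4 * (3 - 2 * sqrt 2) / pi"
  proof -
    have "sqrt 2 \<le> 1.4145" by (rule real_le_lsqrt) (simp_all add: power2_eq_square)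
    then show ?thesis using pi_gt_zero pi_approx by (simp add: field_simps)
  qed
  then have "e * (1 / 5) \<le> e * (4 * (3 - 2 * sqrt 2) / pi)" using e by (intro mult_left_mono)
  ultimately show ?thesis by linarith
qed

section \<open>Points of the unit circle\<close>

definition circle_point :: "real \<Rightarrow> real^2" where
  "circle_point t = vector [cos t, sin t]"

lemma circle_point_nth [simp]: "circle_point t $ 1 = cos t" "circle_point t $ 2 = sin t"
  by (simp_all add: circle_point_def)

lemma inner_circle_point: "circle_point s \<bullet> circle_point t = cos (s - t)"
  by (simp add: inner_vec_def sum_2 cos_diff)

lemma norm_circle_point [simp]: "norm (circle_point t) = 1"
  by (simp add: norm_eq_sqrt_inner inner_circle_point)

lemma circle_point_add_pi: "circle_point (t + pi) = - circle_point t"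
  by (simp add: vec_eq_iff forall_2)

lemma circle_point_add_2pi: "circle_point (t + 2 * pi) = circle_point t"
  by (simp add: vec_eq_iff forall_2)

lemma continuous_on_circle_point: "continuous_on S circle_point"
proof -
  have eq: "circle_point = (\<lambda>t. cos t *\<^sub>R axis 1 1 + sin t *\<^sub>R axis 2 1)"
    by (rule ext) (simp add: vec_eq_iff forall_2 axis_def)
  show ?thesis by (subst eq) (intro continuous_intros)
qed

lemma circle_point_shift:
  fixes k :: int
  shows "circle_point (t + 2 * pi * of_int k) = circle_point t"
proof -
  have "cos (t + 2 * pi * of_int k) = cos t" "sin (t + 2 * pi * of_int k) = sin t"
    unfolding sin_add cos_add cos_int_2pin sin_int_2pin by simp_all
  then show ?thesis by (simp add: vec_eq_iff forall_2)
qed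

lemma unit_vector_eq_circle_point:
  assumes "norm (x :: real^2) = 1"
  obtains t where "c \<le> t" "t < c + 2 * pi" "x = circle_point t"
proof -
  have "(x $ 1)\<^sup>2 + (x $ 2)\<^sup>2 = 1"
    using assms by (simp add: norm_eq_1 inner_vec_def sum_2 power2_eq_square)
  then obtain t where t: "x $ 1 = cos t" "x $ 2 = sin t"
    using sincos_total_2pi by blast
  define k where "k = \<lfloor>(t - c) / (2 * pi)\<rfloor>"
  have "of_int k \<le> (t - c) / (2 * pi)" "(t - c) / (2 * pi) < of_int k + 1"
    unfolding k_def by linarith+
  then have "c \<le> t + 2 * pi * of_int (- k)" "t + 2 * pi * of_int (- k) < c + 2 * pi"
    by (simp_all add: field_simps)
  moreover have "x = circle_point (t + 2 * pi * of_int (- k))"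
    unfolding circle_point_shift using t by (simp add: vec_eq_iff forall_2)
  ultimately show ?thesis using that by blast
qed

lemma circle_point_add:
  "circle_point (s + d) = cos d *\<^sub>R circle_point s + sin d *\<^sub>R circle_point (s + pi/2)"
  by (simp add: vec_eq_iff forall_2 cos_add sin_add)

lemma unit_orthogonal_circle_point:
  assumes "norm w = 1" "circle_point s \<bullet> w = 0"
  shows "w = circle_point (s + pi/2) \<or> w = - circle_point (s + pi/2)"
proof -
  obtain t where t: "w = circle_point t" using unit_vector_eq_circle_point[OF assms(1)] by metis
  have c: "cos (t - s) = 0"
    using assms(2) unfolding t inner_circle_point by (metis cos_minus minus_diff_eq)
  then have "sin (t - s) = 1 \<or> sin (t - s) = - 1"
    using sin_cos_squared_add[of "t - s"] by (simp add: power2_eq_1_iff)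
  moreover have "w = cos (t - s) *\<^sub>R circle_point s + sin (t - s) *\<^sub>R circle_point (s + pi/2)"
    unfolding t using circle_point_add[of s "t - s"] by simp
  ultimately show ?thesis using c by auto
qed

lemma polar_coordinates:
  obtains r t where "0 \<le> r" "c \<le> t" "t < c + 2 * pi" "(x :: real^2) = r *\<^sub>R circle_point t"
proof (cases "x = 0")
  case True
  show ?thesis by (rule that[of 0 c]) (auto simp: True)
next
  case False
  then have "norm (x /\<^sub>R norm x) = 1" by simp
  then obtain t where t: "c \<le> t" "t < c + 2 * pi" "x /\<^sub>R norm x = circle_point t"
    using unit_vector_eq_circle_point by blast
  have "x = norm x *\<^sub>R (x /\<^sub>R norm x)" using False by simp
  then have "x = norm x *\<^sub>R circle_point t" using t(3) by simp
  then show ?thesis using that[of "norm x" t] t by simp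
qed

section \<open>Inscribed polygons\<close>

lemma bounded_triangle: "bounded (convex hull {A, B, C :: real^2})"
  by (simp add: bounded_convex_hull)

lemma triangle_borel [measurable]: "convex hull {A, B, C :: real^2} \<in> sets borel"
  by (intro borel_closed compact_imp_closed compact_convex_hull) simp

lemma measure_triangle_0:
  "measure lborel (convex hull {0, x, y :: real^2}) = \<bar>x $ 1 * y $ 2 - x $ 2 * y $ 1\<bar> / 2"
  unfolding content_triangle by (simp add: abs_minus_commute algebra_simps)

lemma measure_interior_sector_triangle:
  assumes "s \<le> t" "t \<le> s + pi"
  shows "measure lborel (interior (convex hull {0, circle_point s, circle_point t})) = sin (t - s) / 2"
proof -
  have "measure lborel (interior (convex hull {0, circle_point s, circle_point t}))
      = measure lebesgue (interior (convex hull {0, circle_point s, circle_point t}))"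
    by (simp add: borel_open)
  also have "\<dots> = measure lebesgue (convex hull {0, circle_point s, circle_point t})"
    by (rule measure_interior[OF bounded_triangle negligible_convex_frontier]) simp
  also have "\<dots> = measure lborel (convex hull {0, circle_point s, circle_point t})"
    by simp
  also have "\<dots> = \<bar>sin (t - s)\<bar> / 2"
    by (simp add: measure_triangle_0 sin_diff algebra_simps)
  also have "\<dots> = sin (t - s) / 2"
    using assms by (simp add: sin_ge_zero)
  finally show ?thesis .
qed

text \<open>
  The closed triangle lies in the two closed half-planes bounded by the lines through its edges at the
  origin, so its interior lies in the open ones. This argument also covers degenerate triangles,
  whose interior is empty.
\<close>
lemma interior_sector_triangle:
  assumes "s \<le> t" "t \<le> s + pi"
    and "r *\<^sub>R circle_point p \<in> interior (convex hull {0, circle_point s, circle_point t})"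
  shows "0 < r * sin (p - s)" "0 < r * sin (t - p)"
proof -
  have sn: "0 \<le> sin (t - s)" using assms by (simp add: sin_ge_zero)
  have *: "cos (s + pi/2 - p) = sin (p - s)" "cos (t - pi/2 - p) = sin (t - p)" for p s t :: real
    by (simp_all add: cos_add cos_diff sin_add sin_diff)
  { fix a assume "0 \<le> circle_point a \<bullet> circle_point s" "0 \<le> circle_point a \<bullet> circle_point t"
    then have "convex hull {0, circle_point s, circle_point t} \<subseteq> {z. circle_point a \<bullet> z \<ge> 0}"
      by (intro hull_minimal convex_halfspace_ge) auto
    then have "interior (convex hull {0, circle_point s, circle_point t})
        \<subseteq> interior {z. circle_point a \<bullet> z \<ge> 0}"
      by (rule interior_mono)
    also have "\<dots> = {z. circle_point a \<bullet> z > 0}"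
      by (rule interior_halfspace_ge) (metis norm_circle_point norm_zero zero_neq_one)
    finally have "0 < circle_point a \<bullet> (r *\<^sub>R circle_point p)"
      using assms(3) by blast
    then have "0 < r * cos (a - p)" by (simp add: inner_circle_point)
  } note halfplane = this
  show "0 < r * sin (p - s)"
    using halfplane[of "s + pi/2"] sn unfolding inner_circle_point * by simp
  show "0 < r * sin (t - p)"
    using halfplane[of "t - pi/2"] sn unfolding inner_circle_point * by simp
qed

lemma sin_pos_imp:
  assumes "0 < sin x" "x \<le> 2 * pi"
  shows "0 < x \<and> x < pi \<or> x < - pi"
proof (rule ccontr)
  assume "\<not> ?thesis"
  then consider "- pi \<le> x" "x \<le> 0" | "pi \<le> x" by linarith
  then show False
  proof cases
    case 1
    then have "sin x \<le> 0" using sin_ge_zero[of "- x"] by simp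
    then show False using assms by simp
  next
    case 2
    then have "sin x \<le> 0" using sin_le_zero[of x] assms(2) by (cases "x = 2 * pi") auto
    then show False using assms by simp
  qed
qed

text \<open>
  With angles measured from a common starting direction \<open>c\<close>, the interior of the triangle consists of points
  whose polar angle lies strictly between \<open>s\<close> and \<open>t\<close>. Triangles over non-overlapping angular
  intervals therefore have disjoint interiors.
\<close>
lemma interior_sector_triangle_angle:
  assumes "s \<le> t" "t < s + pi" "c \<le> s" "t \<le> c + 2 * pi"
    and "0 \<le> r" "c \<le> p" "p < c + 2 * pi"
    and "r *\<^sub>R circle_point p \<in> interior (convex hull {0, circle_point s, circle_point t})"
  shows "s < p" "p < t"
proof -
  have "0 < r * sin (p - s)" "0 < r * sin (t - p)"
    using interior_sector_triangle[OF _ _ assms(8)] assms by auto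
  then have pos: "0 < sin (p - s)" "0 < sin (t - p)"
    using assms(5) by (auto simp: zero_less_mult_iff)
  have "0 < p - s \<and> p - s < pi \<or> p - s < - pi"
    by (rule sin_pos_imp[OF pos(1)]) (use assms in linarith)+
  moreover have "0 < t - p \<and> t - p < pi \<or> t - p < - pi"
    by (rule sin_pos_imp[OF pos(2)]) (use assms pi_gt_zero in linarith)+
  ultimately show "s < p" "p < t" using assms by linarith+
qed

text \<open>
  The polygon is cut into triangles with a vertex at the origin. Their interiors are disjoint,
  and each has area half the sine of its angle.
\<close>
lemma sum_sin_le_measure:
  fixes \<theta> :: "nat \<Rightarrow> real"
  assumes step: "\<And>i. i < n \<Longrightarrow> \<theta> i \<le> \<theta> (Suc i) \<and> \<theta> (Suc i) < \<theta> i + pi"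
    and turn: "\<theta> n \<le> \<theta> 0 + 2 * pi"
    and K: "compact K" "convex K" "0 \<in> K" "\<And>i. i \<le> n \<Longrightarrow> circle_point (\<theta> i) \<in> K"
  shows "(\<Sum>i<n. sin (\<theta> (Suc i) - \<theta> i)) / 2 \<le> measure lborel K"
proof -
  define T where "T i = interior (convex hull {0, circle_point (\<theta> i), circle_point (\<theta> (Suc i))})" for i
  have mono: "\<theta> i \<le> \<theta> j" if "i \<le> j" "j \<le> n" for i j
    using that
  proof (induction j rule: dec_induct)
    case (step j)
    then show ?case using assms(1)[of j] by simp
  qed simp
  have angle: "\<theta> i < p \<and> p < \<theta> (Suc i)"
    if "i < n" "0 \<le> r" "\<theta> 0 \<le> p" "p < \<theta> 0 + 2 * pi" "r *\<^sub>R circle_point p \<in> T i" for i r p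
    using interior_sector_triangle_angle[of "\<theta> i" "\<theta> (Suc i)" "\<theta> 0" r p] that step[of i] mono[of 0 i]
      mono[of "Suc i" n] turn unfolding T_def by auto
  have disj: "disjoint_family_on T {..<n}"
  proof (rule ccontr)
    assume "\<not> ?thesis"
    then obtain i j x where ij: "i < n" "j < n" "i \<noteq> j" "x \<in> T i" "x \<in> T j"
      unfolding disjoint_family_on_def by blast
    obtain r p where x: "0 \<le> r" "\<theta> 0 \<le> p" "p < \<theta> 0 + 2 * pi" "x = r *\<^sub>R circle_point p"
      using polar_coordinates by blast
    have "\<theta> i < p" "p < \<theta> (Suc i)" "\<theta> j < p" "p < \<theta> (Suc j)"
      using angle ij x by blast+
    then show False
      using ij mono[of "Suc i" j] mono[of "Suc j" i] by (cases "i < j") auto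
  qed
  have Tsub: "T i \<subseteq> K" if "i < n" for i
  proof -
    have "convex hull {0, circle_point (\<theta> i), circle_point (\<theta> (Suc i))} \<subseteq> K"
      using that K by (intro hull_minimal) auto
    then show ?thesis unfolding T_def using interior_subset by blast
  qed
  have T_meas: "T i \<in> fmeasurable lborel" for i
    unfolding T_def
    by (rule fmeasurableI2[OF fmeasurable_compact interior_subset])
      (auto intro: compact_convex_hull borel_open)
  have "(\<Sum>i<n. sin (\<theta> (Suc i) - \<theta> i)) / 2 = (\<Sum>i<n. measure lborel (T i))"
    unfolding sum_divide_distrib T_def using step
    by (intro sum.cong refl measure_interior_sector_triangle[symmetric]) (auto intro: less_imp_le)
  also have "\<dots> = measure lborel (\<Union>i<n. T i)"
    using disj T_meas
    by (intro measure_finite_Union[symmetric]) (auto simp: fmeasurable_def less_top)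
  also have "\<dots> \<le> measure lborel K"
    using Tsub K(1) T_def by (intro measure_mono_fmeasurable) (auto intro: fmeasurable_compact borel_open)
  finally show ?thesis .
qed

section \<open>Circumscribed polygons\<close>

lemma sin_scaleR_circle_point:
  "sin (t - s) *\<^sub>R circle_point p = sin (t - p) *\<^sub>R circle_point s + sin (p - s) *\<^sub>R circle_point t"
  by (simp add: vec_eq_iff forall_2 sin_diff algebra_simps)

lemma circle_point_in_cone:
  assumes "s \<le> p" "p < t" "t \<le> s + pi/2"
  obtains \<alpha> \<beta> where "0 \<le> \<alpha>" "0 \<le> \<beta>" "circle_point p = \<alpha> *\<^sub>R circle_point s + \<beta> *\<^sub>R circle_point t"
proof
  have g: "0 < sin (t - s)" using assms by (intro sin_gt_zero) auto
  show "0 \<le> sin (t - p) / sin (t - s)" "0 \<le> sin (p - s) / sin (t - s)"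
    using assms g by (auto intro!: divide_nonneg_pos sin_ge_zero)
  have "sin (t - s) *\<^sub>R circle_point p = sin (t - s) *\<^sub>R
      ((sin (t - p) / sin (t - s)) *\<^sub>R circle_point s + (sin (p - s) / sin (t - s)) *\<^sub>R circle_point t)"
    using g by (simp add: sin_scaleR_circle_point[of t s p] scaleR_add_right)
  then show "circle_point p =
      (sin (t - p) / sin (t - s)) *\<^sub>R circle_point s + (sin (p - s) / sin (t - s)) *\<^sub>R circle_point t"
    using g by (metis order_less_irrefl scaleR_left_imp_eq)
qed

text \<open>
  The intersection of the tangents to the unit circle at \<open>circle_point s\<close> and \<open>circle_point t\<close>.
\<close>
definition tangent_vertex :: "real \<Rightarrow> real \<Rightarrow> real^2" where
  "tangent_vertex s t = (1 / (1 + cos (t - s))) *\<^sub>R (circle_point s + circle_point t)"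

text \<open>
  The part of a circumscribed polygon between two consecutive points of contact, given as the union of two
  congruent right triangles so that the area formula for triangles applies.
\<close>
definition tangent_kite :: "real \<Rightarrow> real \<Rightarrow> (real^2) set" where
  "tangent_kite s t = convex hull {0, circle_point s, tangent_vertex s t}
     \<union> convex hull {0, circle_point t, tangent_vertex s t}"

lemma tangent_kite_borel: "tangent_kite s t \<in> sets borel"
  unfolding tangent_kite_def by (intro sets.Un triangle_borel)

lemma measure_tangent_kite:
  assumes "s \<le> t" "t \<le> s + pi/2"
  shows "measure lborel (tangent_kite s t) \<le> sin (t - s) / (1 + cos (t - s))"
proof -
  have c: "0 \<le> cos (t - s)" and sn: "0 \<le> sin (t - s)"
    using assms by (auto intro!: cos_ge_zero sin_ge_zero)
  have "measure lborel (convex hull {0, circle_point s, tangent_vertex s t})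
      = \<bar>sin (t - s) / (1 + cos (t - s))\<bar> / 2"
    unfolding measure_triangle_0 tangent_vertex_def
    by (simp add: sin_diff algebra_simps diff_divide_distrib)
  moreover have "measure lborel (convex hull {0, circle_point t, tangent_vertex s t})
      = \<bar>- (sin (t - s) / (1 + cos (t - s)))\<bar> / 2"
    unfolding measure_triangle_0 tangent_vertex_def
    by (simp add: sin_diff algebra_simps diff_divide_distrib)
  moreover have "measure lborel (tangent_kite s t)
      \<le> measure lborel (convex hull {0, circle_point s, tangent_vertex s t})
        + measure lborel (convex hull {0, circle_point t, tangent_vertex s t})"
    unfolding tangent_kite_def by (rule measure_Un_le) (simp_all add: triangle_borel)
  moreover have "0 \<le> sin (t - s) / (1 + cos (t - s))" using c sn by simp
  ultimately show ?thesis
    by (simp only: abs_minus_cancel abs_of_nonneg field_sum_of_halves)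
qed

lemma convex_hull_0_2I:
  fixes x y :: "'a::real_vector"
  assumes "0 \<le> a" "0 \<le> b" "a + b \<le> 1"
  shows "a *\<^sub>R x + b *\<^sub>R y \<in> convex hull {0, x, y}"
  unfolding convex_hull_3
  by (intro CollectI exI[of _ "1 - a - b"] exI[of _ a] exI[of _ b]) (use assms in auto)

text \<open>
  In a cone with an angle of at most a right angle, the two tangent half-planes already cut out the kite: if
  \<open>\<beta> \<le> \<alpha>\<close>, then \<open>x\<close> has coordinates \<open>\<alpha> - \<beta>\<close> and \<open>\<beta> (1 + cos (t - s))\<close> in the triangle at
  \<open>circle_point s\<close>, and their sum is the inner product of \<open>x\<close> with \<open>circle_point s\<close>.
\<close>
lemma tangent_kiteI:
  assumes "s \<le> t" "t \<le> s + pi/2" and ab: "0 \<le> \<alpha>" "0 \<le> \<beta>"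
    and x: "x = \<alpha> *\<^sub>R circle_point s + \<beta> *\<^sub>R circle_point t"
    and le: "x \<bullet> circle_point s \<le> 1" "x \<bullet> circle_point t \<le> 1"
  shows "x \<in> tangent_kite s t"
proof -
  define c where "c = cos (t - s)"
  have c: "0 \<le> c" using assms unfolding c_def by (auto intro!: cos_ge_zero)
  have c': "cos (s - t) = c" unfolding c_def by (metis cos_minus minus_diff_eq)
  have le': "\<alpha> + \<beta> * c \<le> 1" "\<alpha> * c + \<beta> \<le> 1"
    using le unfolding x inner_add_left inner_scaleR_left inner_circle_point c' c_def[symmetric] by simp_all
  have w: "circle_point s + circle_point t = (1 + c) *\<^sub>R tangent_vertex s t"
    using c unfolding tangent_vertex_def c_def[symmetric] by simp
  show ?thesis
  proof (cases "\<beta> \<le> \<alpha>")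
    case True
    have "x = (\<alpha> - \<beta>) *\<^sub>R circle_point s + \<beta> *\<^sub>R (circle_point s + circle_point t)"
      unfolding x by (simp add: algebra_simps)
    also have "\<dots> = (\<alpha> - \<beta>) *\<^sub>R circle_point s + (\<beta> * (1 + c)) *\<^sub>R tangent_vertex s t"
      unfolding w by simp
    also have "\<dots> \<in> convex hull {0, circle_point s, tangent_vertex s t}"
      by (rule convex_hull_0_2I) (use True ab c le' in \<open>auto simp: algebra_simps\<close>)
    finally show ?thesis unfolding tangent_kite_def by simp
  next
    case False
    have "x = (\<beta> - \<alpha>) *\<^sub>R circle_point t + \<alpha> *\<^sub>R (circle_point s + circle_point t)"
      unfolding x by (simp add: algebra_simps)
    also have "\<dots> = (\<beta> - \<alpha>) *\<^sub>R circle_point t + (\<alpha> * (1 + c)) *\<^sub>R tangent_vertex s t"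
      unfolding w by simp
    also have "\<dots> \<in> convex hull {0, circle_point t, tangent_vertex s t}"
      by (rule convex_hull_0_2I) (use False ab c le' in \<open>auto simp: algebra_simps\<close>)
    finally show ?thesis unfolding tangent_kite_def by simp
  qed
qed

lemma interval_step_containing:
  fixes \<theta> :: "nat \<Rightarrow> 'a::linorder"
  assumes "\<theta> 0 \<le> p" "p < \<theta> n"
  shows "\<exists>i<n. \<theta> i \<le> p \<and> p < \<theta> (Suc i)"
  using assms
proof (induction n)
  case (Suc n)
  then show ?case by (cases "p < \<theta> n") (auto simp: less_Suc_eq)
qed simp

lemma circumscribed_subset_kites:
  fixes \<theta> :: "nat \<Rightarrow> real"
  assumes step: "\<And>i. i < n \<Longrightarrow> \<theta> i \<le> \<theta> (Suc i) \<and> \<theta> (Suc i) \<le> \<theta> i + pi/2"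
    and turn: "\<theta> n = \<theta> 0 + 2 * pi"
  shows "{x. \<forall>i\<le>n. x \<bullet> circle_point (\<theta> i) \<le> 1} \<subseteq> (\<Union>i<n. tangent_kite (\<theta> i) (\<theta> (Suc i)))"
proof
  fix x assume x: "x \<in> {x. \<forall>i\<le>n. x \<bullet> circle_point (\<theta> i) \<le> 1}"
  obtain r p where p: "0 \<le> r" "\<theta> 0 \<le> p" "p < \<theta> 0 + 2 * pi" "x = r *\<^sub>R circle_point p"
    using polar_coordinates by blast
  obtain i where i: "i < n" "\<theta> i \<le> p" "p < \<theta> (Suc i)"
    using interval_step_containing[of \<theta> p n] p turn by auto
  obtain \<alpha> \<beta> where ab: "0 \<le> \<alpha>" "0 \<le> \<beta>"
      "circle_point p = \<alpha> *\<^sub>R circle_point (\<theta> i) + \<beta> *\<^sub>R circle_point (\<theta> (Suc i))"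
    using circle_point_in_cone[OF i(2,3)] step[OF i(1)] by blast
  have "x \<in> tangent_kite (\<theta> i) (\<theta> (Suc i))"
  proof (rule tangent_kiteI)
    show "x = (r * \<alpha>) *\<^sub>R circle_point (\<theta> i) + (r * \<beta>) *\<^sub>R circle_point (\<theta> (Suc i))"
      unfolding p(4) ab(3) by (simp add: scaleR_add_right)
  qed (use step[OF i(1)] ab p x i in auto)
  then show "x \<in> (\<Union>i<n. tangent_kite (\<theta> i) (\<theta> (Suc i)))" using i by blast
qed

text \<open>
  Every point lies in the cone between two consecutive contact points, so the kites cover the polygon; the
  kite over a gap \<open>g\<close> has area \<open>tan (g / 2)\<close>. An upper bound only needs a cover, so
  overlaps are harmless.
\<close>
lemma measure_circumscribed_le:
  fixes \<theta> :: "nat \<Rightarrow> real"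
  assumes step: "\<And>i. i < n \<Longrightarrow> \<theta> i \<le> \<theta> (Suc i) \<and> \<theta> (Suc i) \<le> \<theta> i + pi/2"
    and turn: "\<theta> n = \<theta> 0 + 2 * pi"
    and P: "closed P" "P \<subseteq> {x. \<forall>i\<le>n. x \<bullet> circle_point (\<theta> i) \<le> 1}"
  shows "measure lborel P \<le> (\<Sum>i<n. sin (\<theta> (Suc i) - \<theta> i) / (1 + cos (\<theta> (Suc i) - \<theta> i)))"
proof -
  let ?K = "\<lambda>i. tangent_kite (\<theta> i) (\<theta> (Suc i))"
  have K: "?K i \<in> fmeasurable lborel" for i
    unfolding tangent_kite_def
    by (intro fmeasurable_compact compact_Un compact_convex_hull) auto
  have "measure lborel P \<le> measure lborel (\<Union>i<n. ?K i)"
    using P circumscribed_subset_kites[OF step turn] K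
    by (intro measure_mono_fmeasurable fmeasurable.finite_UN) (auto intro: borel_closed)
  also have "\<dots> \<le> (\<Sum>i<n. measure lborel (?K i))"
    by (rule measure_UNION_le) (simp_all add: tangent_kite_borel)
  also have "\<dots> \<le> (\<Sum>i<n. sin (\<theta> (Suc i) - \<theta> i) / (1 + cos (\<theta> (Suc i) - \<theta> i)))"
    by (intro sum_mono measure_tangent_kite) (use step in auto)
  finally show ?thesis .
qed

section \<open>The support of an even isotropic measure\<close>

lemma circle_measure_space:
  assumes "circle_measure \<mu>"
  shows "space \<mu> = sphere 0 1"
  using sets_eq_imp_space_eq[OF assms[unfolded circle_measure_def]] by (simp add: space_restrict_space)

lemma circle_measure_open_sets:
  assumes "circle_measure \<mu>" "open U"
  shows "U \<inter> space \<mu> \<in> sets \<mu>"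
  using assms circle_measure_space[OF assms(1)]
  unfolding circle_measure_def by (auto simp: sets_restrict_space Int_commute)

lemma supp_subset_sphere:
  assumes "circle_measure \<mu>"
  shows "supp \<mu> \<subseteq> sphere 0 1"
  using circle_measure_space[OF assms] by (auto simp: supp_def)

lemma closed_supp:
  assumes "circle_measure \<mu>"
  shows "closed (supp \<mu>)"
proof -
  define N where "N = \<Union>{U. open U \<and> emeasure \<mu> (U \<inter> space \<mu>) = 0}"
  have "supp \<mu> = sphere 0 1 - N"
    unfolding supp_def circle_measure_space[OF assms] N_def
    by (auto simp: zero_less_iff_neq_zero)
  moreover have "open N" unfolding N_def by auto
  ultimately show ?thesis by (simp add: closed_Diff)
qed

lemma supp_uminus:
  assumes \<mu>: "circle_measure \<mu>" "even_measure \<mu>" and x: "x \<in> supp \<mu>"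
  shows "- x \<in> supp \<mu>"
proof -
  have sp: "space \<mu> = sphere 0 1" by (rule circle_measure_space[OF \<mu>(1)])
  have "0 < emeasure \<mu> (U \<inter> space \<mu>)" if U: "open U" "- x \<in> U" for U
  proof -
    have V: "open (uminus ` U)" "x \<in> uminus ` U"
      using U by (auto simp: open_negations image_iff intro: bexI[of _ "- x"])
    have "U \<inter> space \<mu> = uminus ` (uminus ` U \<inter> space \<mu>)"
      unfolding sp by (force simp: image_iff)
    then have "emeasure \<mu> (U \<inter> space \<mu>) = emeasure \<mu> (uminus ` U \<inter> space \<mu>)"
      using \<mu>(2) circle_measure_open_sets[OF \<mu>(1) V(1)] unfolding even_measure_def by simp
    then show ?thesis using x V unfolding supp_def by auto
  qed
  moreover have "- x \<in> space \<mu>" using x by (auto simp: supp_def sp)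
  ultimately show ?thesis unfolding supp_def by blast
qed

text \<open>
  The topology has a countable base, so countably many null sets cover the complement of the support.
\<close>
lemma AE_supp:
  assumes "circle_measure \<mu>"
  shows "AE x in \<mu>. x \<in> supp \<mu>"
proof -
  obtain B :: "(real^2) set set" where B: "countable B" "topological_basis B"
    using ex_countable_basis by blast
  define N where "N = (\<Union>U\<in>{U \<in> B. emeasure \<mu> (U \<inter> space \<mu>) = 0}. U \<inter> space \<mu>)"
  have "N \<in> null_sets \<mu>"
    unfolding N_def
  proof (rule null_sets_UN')
    fix U assume "U \<in> {U \<in> B. emeasure \<mu> (U \<inter> space \<mu>) = 0}"
    then show "U \<inter> space \<mu> \<in> null_sets \<mu>"
      using circle_measure_open_sets[OF assms] topological_basis_open[OF B(2)] by auto
  qed (use B(1) in auto)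
  moreover have "{x \<in> space \<mu>. x \<notin> supp \<mu>} \<subseteq> N"
  proof
    fix x assume "x \<in> {x \<in> space \<mu>. x \<notin> supp \<mu>}"
    then obtain U where U: "x \<in> space \<mu>" "open U" "x \<in> U" "emeasure \<mu> (U \<inter> space \<mu>) = 0"
      unfolding supp_def by (auto simp: zero_less_iff_neq_zero)
    obtain V where V: "V \<in> B" "x \<in> V" "V \<subseteq> U"
      using topological_basisE[OF B(2) U(2,3)] by blast
    have "emeasure \<mu> (V \<inter> space \<mu>) \<le> emeasure \<mu> (U \<inter> space \<mu>)"
      using V U circle_measure_open_sets[OF assms] by (intro emeasure_mono) auto
    then show "x \<in> N" using U V unfolding N_def by auto
  qed
  ultimately show ?thesis by (rule AE_I'[rotated 0])
qed

text \<open>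
  The entrywise identity of matrices, paired with the bilinear form of \<open>u\<close> and \<open>v\<close>.
\<close>
lemma isotropic_inner_product:
  assumes "isotropic \<mu>"
  shows "has_bochner_integral \<mu> (\<lambda>x. (x \<bullet> u) * (x \<bullet> v)) (u \<bullet> v)"
proof -
  have "linear (\<lambda>M :: real^2^2. u \<bullet> (M *v v))"
    by (rule linearI) (simp_all add: matrix_vector_mult_add_rdistrib inner_add_right
        scaleR_matrix_vector_assoc[symmetric])
  then have "bounded_linear (\<lambda>M :: real^2^2. u \<bullet> (M *v v))"
    by (simp add: linear_conv_bounded_linear)
  from has_bochner_integral_bounded_linear[OF this assms[unfolded isotropic_def]]
  have "has_bochner_integral \<mu> (\<lambda>x. u \<bullet> (tensor_square x *v v)) (u \<bullet> v)" by simp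
  moreover have "u \<bullet> (tensor_square x *v v) = (x \<bullet> u) * (x \<bullet> v)" for x
    by (simp add: tensor_square_def inner_vec_def matrix_vector_mult_def sum_2 algebra_simps)
  ultimately show ?thesis by simp
qed

text \<open>
  This is where isotropy enters. Otherwise, by symmetry, \<open>(x \<bullet> u) (x \<bullet> v)\<close> would be negative
  at every point \<open>x\<close> of the support off the line orthogonal to \<open>v\<close>. Its integral \<open>u \<bullet> v\<close> vanishes, so the
  measure would be concentrated on that line, against \<open>\<integral> (x \<bullet> v)\<^sup>2 d\<mu> = v \<bullet> v\<close>.
\<close>
lemma supp_meets_quadrant:
  assumes \<mu>: "circle_measure \<mu>" "even_measure \<mu>" "isotropic \<mu>"
    and uv: "u \<bullet> v = 0" "v \<noteq> 0"
  shows "\<exists>x\<in>supp \<mu>. 0 \<le> x \<bullet> u \<and> 0 < x \<bullet> v"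
proof (rule ccontr)
  assume none: "\<not> ?thesis"
  have neg: "(x \<bullet> u) * (x \<bullet> v) < 0" if "x \<in> supp \<mu>" "x \<bullet> v \<noteq> 0" for x
  proof (cases "0 < x \<bullet> v")
    case True
    then have "x \<bullet> u < 0" using none that by force
    then show ?thesis using True by (simp add: mult_less_0_iff)
  next
    case False
    then have v: "0 < (- x) \<bullet> v" using that by simp
    then have "(- x) \<bullet> u < 0" using none supp_uminus[OF \<mu>(1,2) that(1)] by force
    then show ?thesis using v by (simp add: mult_less_0_iff)
  qed
  have sq: "has_bochner_integral \<mu> (\<lambda>x. (x \<bullet> v) * (x \<bullet> v)) (v \<bullet> v)"
    and uv_int: "has_bochner_integral \<mu> (\<lambda>x. (x \<bullet> u) * (x \<bullet> v)) (u \<bullet> v)"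
    using isotropic_inner_product[OF \<mu>(3)] by blast+
  have "AE x in \<mu>. - ((x \<bullet> u) * (x \<bullet> v)) = 0"
  proof (subst integral_nonneg_eq_0_iff_AE[symmetric])
    show "integrable \<mu> (\<lambda>x. - ((x \<bullet> u) * (x \<bullet> v)))"
      using uv_int by (simp add: has_bochner_integral_iff)
    show "AE x in \<mu>. 0 \<le> - ((x \<bullet> u) * (x \<bullet> v))"
      using AE_supp[OF \<mu>(1)] by eventually_elim (use neg in fastforce)
    show "(\<integral>x. - ((x \<bullet> u) * (x \<bullet> v)) \<partial>\<mu>) = 0"
      using uv_int uv by (simp add: has_bochner_integral_iff)
  qed
  then have "AE x in \<mu>. (x \<bullet> v) * (x \<bullet> v) = 0"
    using AE_supp[OF \<mu>(1)] by eventually_elim (use neg in fastforce)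
  then have "(\<integral>x. (x \<bullet> v) * (x \<bullet> v) \<partial>\<mu>) = 0"
    by (rule integral_eq_zero_AE)
  then show False using sq uv by (simp add: has_bochner_integral_iff)
qed

text \<open>
  The quadrant between \<open>\<theta>\<close> and \<open>\<theta> + \<pi>/2\<close>, in terms of angles: gaps of the support are at most
  right angles.
\<close>
lemma supp_next_point:
  assumes "circle_measure \<mu>" "even_measure \<mu>" "isotropic \<mu>"
  shows "\<exists>t. \<theta> < t \<and> t \<le> \<theta> + pi/2 \<and> circle_point t \<in> supp \<mu>"
proof -
  have "circle_point \<theta> \<bullet> circle_point (\<theta> + pi/2) = 0" by (simp add: inner_circle_point)
  moreover have "circle_point (\<theta> + pi/2) \<noteq> 0" by (metis norm_circle_point norm_zero zero_neq_one)
  ultimately obtain x where x: "x \<in> supp \<mu>" "0 \<le> x \<bullet> circle_point \<theta>"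
      "0 < x \<bullet> circle_point (\<theta> + pi/2)"
    using supp_meets_quadrant[OF assms] by blast
  have "norm x = 1" using supp_subset_sphere[OF assms(1)] x(1) by auto
  then obtain t where t: "\<theta> \<le> t" "t < \<theta> + 2 * pi" "x = circle_point t"
    using unit_vector_eq_circle_point by metis
  have c: "0 \<le> cos (t - \<theta>)" and sn: "0 < sin (t - \<theta>)"
    using x(2,3) unfolding t(3) inner_circle_point
    by (simp_all add: cos_add cos_diff sin_add sin_diff algebra_simps)
  have pos: "0 < t - \<theta>" "t - \<theta> < pi"
    using sin_pos_imp[OF sn] t(1,2) pi_gt_zero by linarith+
  have "t - \<theta> \<le> pi/2"
  proof (rule ccontr)
    assume "\<not> ?thesis"
    then have "cos (t - \<theta>) < cos (pi/2)" using pos by (intro cos_monotone_0_pi) auto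
    then show False using c by simp
  qed
  then show ?thesis using pos x(1) t(3) by (intro exI[of _ t]) auto
qed

section \<open>Distance from the crosses\<close>

lemma inner_div_norm_bounds: "- 1 \<le> x \<bullet> y / (norm x * norm y)" "x \<bullet> y / (norm x * norm y) \<le> 1"
proof -
  have "\<bar>x \<bullet> y / (norm x * norm y)\<bar> \<le> 1"
    using Cauchy_Schwarz_ineq2[of x y] by (simp add: divide_le_eq)
  then show "- 1 \<le> x \<bullet> y / (norm x * norm y)" "x \<bullet> y / (norm x * norm y) \<le> 1" by linarith+
qed

lemma angle_nonneg: "0 \<le> angle x y"
  unfolding angle_def by (intro arccos_lbound inner_div_norm_bounds)

lemma angle_le_pi: "angle x y \<le> pi"
  unfolding angle_def by (intro arccos_ubound inner_div_norm_bounds)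

lemma angle_refl: "norm x = 1 \<Longrightarrow> angle x x = 0"
  by (metis angle_def arccos_1 div_by_1 mult_1 norm_eq_1)

lemma inner_less_cos:
  assumes "norm x = 1" "norm y = 1" "0 \<le> e" "e < angle x y"
  shows "x \<bullet> y < cos e"
proof -
  have "cos (angle x y) < cos e"
    using assms angle_le_pi by (intro cos_monotone_0_pi) auto
  moreover have "cos (angle x y) = x \<bullet> y"
    using inner_div_norm_bounds[of x y] assms(1,2) unfolding angle_def by simp
  ultimately show ?thesis by simp
qed

lemma INF_angle_le:
  assumes "y \<in> Y"
  shows "(INF y\<in>Y. angle x y) \<le> angle x y" "(INF y\<in>Y. angle y x) \<le> angle y x"
  using assms by (auto intro!: cINF_lower bdd_belowI2[of _ 0] angle_nonneg)

lemma spherical_hausdorff_nonneg: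
  assumes "finite Y" "Y \<noteq> {}" "X \<noteq> {}"
  shows "0 \<le> spherical_hausdorff X Y"
proof -
  obtain y where y: "y \<in> Y" using assms by blast
  have "0 \<le> (INF x\<in>X. angle x y)"
    using assms(3) by (intro cINF_greatest angle_nonneg)
  also have "\<dots> \<le> (SUP y\<in>Y. INF x\<in>X. angle x y)"
    using assms(1) y by (intro cSUP_upper) auto
  finally show ?thesis unfolding spherical_hausdorff_def by simp
qed

text \<open>
  Suprema need not be attained, but a value strictly below a supremum is exceeded. The finite set
  \<open>Y\<close> will be the support of a cross.
\<close>
lemma spherical_hausdorff_greater_cases:
  assumes "finite Y" "Y \<noteq> {}" "X \<noteq> {}" and "e < spherical_hausdorff X Y"
  obtains (point) x where "x \<in> X" "\<And>y. y \<in> Y \<Longrightarrow> e < angle x y"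
        | (hole) y where "y \<in> Y" "\<And>x. x \<in> X \<Longrightarrow> e < angle x y"
proof -
  consider "e < (SUP x\<in>X. INF y\<in>Y. angle x y)" | "e < (SUP y\<in>Y. INF x\<in>X. angle x y)"
    using assms(4) unfolding spherical_hausdorff_def by linarith
  then show ?thesis
  proof cases
    case 1
    have "bdd_above ((\<lambda>x. INF y\<in>Y. angle x y) ` X)"
    proof (rule bdd_aboveI2)
      fix x
      obtain y where "y \<in> Y" using assms by blast
      then show "(INF y\<in>Y. angle x y) \<le> pi"
        using INF_angle_le(1)[of y Y x] angle_le_pi[of x y] by linarith
    qed
    then obtain x where x: "x \<in> X" "e < (INF y\<in>Y. angle x y)"
      using 1 assms less_cSUP_iff[of X "\<lambda>x. INF y\<in>Y. angle x y" e] by blast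
    then have "e < angle x y" if "y \<in> Y" for y
      using INF_angle_le(1)[OF that, of x] by linarith
    then show ?thesis using point x by blast
  next
    case 2
    have "bdd_above ((\<lambda>y. INF x\<in>X. angle x y) ` Y)" using assms by simp
    then obtain y where y: "y \<in> Y" "e < (INF x\<in>X. angle x y)"
      using 2 assms less_cSUP_iff[of Y "\<lambda>y. INF x\<in>X. angle x y" e] by blast
    then have "e < angle x y" if "x \<in> X" for x
      using INF_angle_le(2)[OF that, of y] by linarith
    then show ?thesis using hole y by blast
  qed
qed

text \<open>
  An orthogonal map carries one cross to any other, so the infimum may be tested on a cross through
  \<open>circle_point s\<close>.
\<close>
lemma spherical_hausdorff_O_le_cross:
  assumes X: "X \<noteq> {}" and u: "norm u1 = 1" "norm u2 = 1" "u1 \<bullet> u2 = 0"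
  shows "spherical_hausdorff_O X {u1, - u1, u2, - u2}
    \<le> spherical_hausdorff X {circle_point s, - circle_point s,
        circle_point (s + pi/2), - circle_point (s + pi/2)}"
proof -
  obtain \<Phi> where \<Phi>: "orthogonal_transformation \<Phi>" "\<Phi> u1 = circle_point s"
    using orthogonal_transformation_exists[of u1 "circle_point s"] u by auto
  have inner: "\<Phi> x \<bullet> \<Phi> y = x \<bullet> y" for x y
    using \<Phi>(1) unfolding orthogonal_transformation_def by blast
  have "norm (\<Phi> u2) = 1" "circle_point s \<bullet> \<Phi> u2 = 0"
    using inner[of u1 u2] inner[of u2 u2] u unfolding \<Phi>(2) norm_eq_1 by simp_all
  then have "\<Phi> u2 = circle_point (s + pi/2) \<or> \<Phi> u2 = - circle_point (s + pi/2)"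
    by (rule unit_orthogonal_circle_point)
  moreover have "\<Phi> (- x) = - \<Phi> x" for x
    using \<Phi>(1) by (simp add: orthogonal_transformation_linear linear_neg)
  ultimately have im: "\<Phi> ` {u1, - u1, u2, - u2} = {circle_point s, - circle_point s,
        circle_point (s + pi/2), - circle_point (s + pi/2)}"
    using \<Phi>(2) by auto
  have "bdd_below ((\<lambda>\<Phi>. spherical_hausdorff X (\<Phi> ` {u1, - u1, u2, - u2}))
      ` {\<Phi>. orthogonal_transformation \<Phi>})"
    by (rule bdd_belowI2[of _ 0], rule spherical_hausdorff_nonneg) (use X in auto)
  then have "spherical_hausdorff_O X {u1, - u1, u2, - u2}
      \<le> spherical_hausdorff X (\<Phi> ` {u1, - u1, u2, - u2})"
    unfolding spherical_hausdorff_O_def by (rule cINF_lower) (use \<Phi> in auto)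
  then show ?thesis unfolding im .
qed

text \<open>
  A point \<open>x\<close> that is at an angle of more than \<open>e\<close> from all four points of the cross through
  \<open>circle_point s\<close> can, up to sign, be
  assumed to lie in the upper half turn after \<open>s\<close>. It then forms the required pair with
  \<open>circle_point s\<close> if it lies in the first quadrant, and with \<open>- circle_point s\<close> if it lies
  in the second.
\<close>
lemma off_axes_gap:
  assumes S: "S \<subseteq> sphere 0 1" "\<And>x. x \<in> S \<Longrightarrow> - x \<in> S"
    and s: "circle_point s \<in> S" and x: "x \<in> S"
    and e: "0 \<le> e" "e \<le> pi" "\<bar>circle_point s \<bullet> x\<bar> < cos e" "\<bar>circle_point (s + pi/2) \<bullet> x\<bar> < cos e"
  shows "\<exists>s a. e \<le> a \<and> a \<le> pi/2 - e \<and> circle_point s \<in> S \<and> circle_point (s + a) \<in> S"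
proof -
  have small: "e < d" if "0 \<le> d" "cos d < cos e" for d
    using that cos_monotone_0_pi_le[of d e] by (metis linorder_not_less e(2))
  obtain t where t: "s \<le> t" "t < s + 2 * pi" "x = circle_point t"
    using unit_vector_eq_circle_point S(1) x by (metis mem_sphere_0 subsetD)
  have trig: "\<bar>cos (t - s)\<bar> < cos e" "\<bar>sin (t - s)\<bar> < cos e"
    using e(3,4) unfolding t(3) inner_circle_point
    by (simp_all add: cos_add cos_diff sin_add sin_diff algebra_simps)
  obtain d where d: "0 \<le> d" "d < pi" "circle_point (s + d) \<in> S" "\<bar>cos d\<bar> < cos e" "\<bar>sin d\<bar> < cos e"
  proof (cases "t < s + pi")
    case True
    then show ?thesis using that[of "t - s"] t trig x by simp
  next
    case False
    have "circle_point (s + (t - s - pi)) = - x"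
      using circle_point_add_pi[of "t - pi"] t(3) by simp
    then show ?thesis using that[of "t - s - pi"] False t trig S(2)[OF x] by simp
  qed
  show ?thesis
  proof (cases "d \<le> pi/2")
    case True
    have "e < d" using small d by simp
    moreover have "e < pi/2 - d"
      using small[of "pi/2 - d"] True d(5) by (simp add: cos_diff)
    ultimately show ?thesis using s d by (intro exI[of _ s] exI[of _ d]) simp
  next
    case False
    have "e < pi - d" using small[of "pi - d"] d by (simp add: cos_diff)
    moreover have "e < d - pi/2" using small[of "d - pi/2"] False d by (simp add: cos_diff)
    moreover have "circle_point (s + d + (pi - d)) \<in> S"
      using S(2)[OF s] by (simp add: circle_point_add_pi)
    ultimately show ?thesis using d by (intro exI[of _ "s + d"] exI[of _ "pi - d"]) simp
  qed
qed

text \<open>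
  Take the cross through a point of \<open>S\<close>. If its distance from \<open>S\<close> exceeds \<open>e\<close> because some point of
  \<open>S\<close> is far from the cross, this point does the job. Otherwise some point of the cross, necessarily on the
  second axis, is far from all of \<open>S\<close>; then any point of \<open>S\<close> at an angle between \<open>\<pi>/4\<close> and \<open>3\<pi>/4\<close>
  from the first axis is far from both axes.
\<close>
lemma far_from_crosses:
  assumes S: "S \<subseteq> sphere 0 1" "\<And>x. x \<in> S \<Longrightarrow> - x \<in> S"
    and gap: "\<And>\<theta>. \<exists>t. \<theta> < t \<and> t \<le> \<theta> + pi/2 \<and> circle_point t \<in> S"
    and u: "norm u1 = 1" "norm u2 = 1" "u1 \<bullet> u2 = 0"
    and e: "0 \<le> e" "e \<le> pi" "e < spherical_hausdorff_O S {u1, - u1, u2, - u2}"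
  shows "\<exists>s a. e \<le> a \<and> a \<le> pi/2 - e \<and> circle_point s \<in> S \<and> circle_point (s + a) \<in> S"
proof -
  obtain s where s: "circle_point s \<in> S" using gap by blast
  let ?u = "circle_point s" and ?v = "circle_point (s + pi/2)"
  let ?Y = "{?u, - ?u, ?v, - ?v}"
  have ne: "S \<noteq> {}" using s by blast
  have unit: "norm x = 1" if "x \<in> S" for x using S(1) that by auto
  have bound: "\<bar>w \<bullet> x\<bar> < cos e"
    if "x \<in> S" "norm w = 1" "e < angle x w" "e < angle x (- w) \<or> e < angle (- x) w" for x w
    using inner_less_cos[of x w e] inner_less_cos[of x "- w" e] inner_less_cos[of "- x" w e]
      unit that e by (auto simp: inner_commute)
  have Y: "finite ?Y" "?Y \<noteq> {}" by simp_all
  have far: "e < spherical_hausdorff S ?Y"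
    using spherical_hausdorff_O_le_cross[OF ne u, of s] e(3) by linarith
  from Y ne far have "\<exists>x\<in>S. \<bar>?u \<bullet> x\<bar> < cos e \<and> \<bar>?v \<bullet> x\<bar> < cos e"
  proof (cases rule: spherical_hausdorff_greater_cases)
    case (point x)
    then show ?thesis using bound by (intro bexI[of _ x]) auto
  next
    case (hole y)
    have "y \<noteq> ?u" "y \<noteq> - ?u"
      using hole(2)[of y] s S(2)[OF s] e(1) by (auto simp: angle_refl)
    then have y: "y = ?v \<or> y = - ?v" using hole(1) by blast
    have v: "\<bar>?v \<bullet> x\<bar> < cos e" if "x \<in> S" for x
      using y bound[OF that, of y] hole(2)[OF that] hole(2)[OF S(2)[OF that]] by auto
    obtain t where t: "s + pi/4 < t" "t \<le> s + pi/4 + pi/2" "circle_point t \<in> S"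
      using gap by blast
    have trig: "?u \<bullet> circle_point t = cos (t - s)" "?v \<bullet> circle_point t = sin (t - s)"
      unfolding inner_circle_point by (simp_all add: cos_add cos_diff sin_add sin_diff)
    have "sin (pi/4) \<le> sin (t - s)"
    proof (cases "t - s \<le> pi/2")
      case True
      then show ?thesis using t by (intro sin_monotone_2pi_le) auto
    next
      case False
      then have "sin (pi/4) \<le> sin (pi - (t - s))" using t by (intro sin_monotone_2pi_le) auto
      then show ?thesis by (simp only: sin_pi_minus)
    qed
    then have "(sqrt 2 / 2)\<^sup>2 \<le> (sin (t - s))\<^sup>2" unfolding sin_45 by (intro power_mono) auto
    then have "1 / 2 \<le> (sin (t - s))\<^sup>2" by (simp add: power_divide)
    then have "(cos (t - s))\<^sup>2 \<le> (sin (t - s))\<^sup>2"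
      using sin_cos_squared_add[of "t - s"] by linarith
    then have "\<bar>cos (t - s)\<bar> \<le> \<bar>sin (t - s)\<bar>" by (simp add: abs_le_square_iff)
    then show ?thesis using v[OF t(3)] t(3) trig by (intro bexI[of _ "circle_point t"]) auto
  qed
  then obtain x where x: "x \<in> S" "\<bar>?u \<bullet> x\<bar> < cos e" "\<bar>?v \<bullet> x\<bar> < cos e" by blast
  show ?thesis
  proof (rule off_axes_gap[OF S(1) _ s x(1) e(1,2) x(2,3)])
    show "- x \<in> S" if "x \<in> S" for x using that by (rule S(2))
  qed
qed

text \<open>
  Starting from \<open>s + a\<close>, take the last point \<open>l\<close> of \<open>S\<close> within a right angle and then, unless \<open>l\<close>
  is already within a right angle of \<open>s + \<pi>\<close>, one more point \<open>r\<close>. By the choice of \<open>l\<close>, the point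
  \<open>r\<close> lies beyond \<open>s + a + \<pi>/2\<close>, hence within a right angle of \<open>s + \<pi>\<close>.
\<close>
lemma three_more_gaps:
  assumes S: "closed S" "\<And>x. x \<in> S \<Longrightarrow> - x \<in> S"
    and gap: "\<And>\<theta>. \<exists>t. \<theta> < t \<and> t \<le> \<theta> + pi/2 \<and> circle_point t \<in> S"
    and sa: "circle_point s \<in> S" "circle_point (s + a) \<in> S" "0 \<le> a" "a \<le> pi/2"
  obtains x y z where "x \<in> {0..pi/2}" "y \<in> {0..pi/2}" "z \<in> {0..pi/2}" "a + x + y + z = pi"
    "circle_point (s + a + x) \<in> S" "circle_point (s + a + x + y) \<in> S"
proof -
  define A where "A = {s + a..s + a + pi/2} \<inter> circle_point -` S"
  have "closed (circle_point -` S)"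
    by (rule continuous_closed_vimage[OF S(1)])
      (use continuous_on_circle_point[of UNIV] in \<open>simp add: continuous_on_eq_continuous_at\<close>)
  then have "compact A" unfolding A_def by (intro compact_Int_closed) auto
  moreover have "s + a \<in> A" unfolding A_def using sa by simp
  ultimately obtain l where l: "l \<in> A" "\<And>t. t \<in> A \<Longrightarrow> t \<le> l"
    using compact_attains_sup[of A] by blast
  show ?thesis
  proof (cases "s + pi/2 \<le> l")
    case True
    then show ?thesis
      using that[of "l - (s + a)" 0 "s + pi - l"] l(1) sa unfolding A_def by auto
  next
    case False
    obtain r where r: "l < r" "r \<le> l + pi/2" "circle_point r \<in> S" using gap by blast
    have "r \<notin> A" using l(2)[of r] r(1) by auto
    then have "s + a + pi/2 < r" using r l(1) unfolding A_def by auto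
    then show ?thesis
      using that[of "l - (s + a)" "r - l" "s + pi - r"] False l(1) r sa unfolding A_def by auto
  qed
qed

section \<open>Areas of the two bodies\<close>

text \<open>
  Together with their antipodes, the points of \<open>S\<close> at the ends of the gaps \<open>a\<close>, \<open>x\<close>, \<open>y\<close>, \<open>z\<close> form a
  centrally symmetric octagon, possibly with repeated vertices. The octagon is contained in the convex hull of
  \<open>S\<close> and its polar contains that of \<open>S\<close>. So the areas are estimated by sums over the gaps.
\<close>
lemma area_estimates:
  assumes S: "closed S" "S \<subseteq> sphere 0 1" "\<And>x. x \<in> S \<Longrightarrow> - x \<in> S"
    and gap: "\<And>\<theta>. \<exists>t. \<theta> < t \<and> t \<le> \<theta> + pi/2 \<and> circle_point t \<in> S"
    and sa: "circle_point s \<in> S" "circle_point (s + a) \<in> S"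
    and e: "0 \<le> e" "e \<le> a" "a \<le> pi/2 - e"
  shows "2 + e / 2 \<le> measure lborel (convex hull S)"
    and "measure lborel {x. \<forall>u\<in>S. x \<bullet> u \<le> 1} \<le> 4 - 2 * e / 5"
proof -
  have a: "0 \<le> a" "a \<le> pi/2" using e by auto
  obtain x y z where xyz: "x \<in> {0..pi/2}" "y \<in> {0..pi/2}" "z \<in> {0..pi/2}" "a + x + y + z = pi"
    and pts: "circle_point (s + a + x) \<in> S" "circle_point (s + a + x + y) \<in> S"
    by (rule three_more_gaps[OF S(1,3) gap sa a], assumption)
  define L where "L = [s, s + a, s + a + x, s + a + x + y,
    s + pi, s + a + pi, s + a + x + pi, s + a + x + y + pi, s + 2 * pi]"
  have length_L: "length L = 9" by (simp add: L_def)
  define \<theta> where "\<theta> i = L ! i" for i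
  have in_S: "circle_point (\<theta> i) \<in> S" if "i \<le> 8" for i
  proof -
    have "\<theta> i \<in> set L" unfolding \<theta>_def using that length_L by (intro nth_mem) linarith
    moreover have "\<forall>t\<in>set L. circle_point t \<in> S"
      using sa pts S(3) by (simp add: L_def circle_point_add_pi circle_point_add_2pi)
    ultimately show ?thesis by blast
  qed
  have \<theta>: "\<theta> 0 = s" "\<theta> 1 = s + a" "\<theta> 2 = s + a + x" "\<theta> 3 = s + a + x + y" "\<theta> 4 = s + pi"
    "\<theta> 5 = s + a + pi" "\<theta> 6 = s + a + x + pi" "\<theta> 7 = s + a + x + y + pi" "\<theta> 8 = s + 2 * pi"
    by (simp_all add: \<theta>_def L_def)
  have gap_values: "\<theta> 1 - \<theta> 0 = a" "\<theta> 2 - \<theta> 1 = x" "\<theta> 3 - \<theta> 2 = y" "\<theta> 4 - \<theta> 3 = z"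
    "\<theta> 5 - \<theta> 4 = a" "\<theta> 6 - \<theta> 5 = x" "\<theta> 7 - \<theta> 6 = y" "\<theta> 8 - \<theta> 7 = z"
    unfolding \<theta> using xyz(4) by linarith+
  have eight: "{..<8} = {0, 1, 2, 3, 4, 5, 6, 7 :: nat}"
    by (simp add: lessThan_nat_numeral lessThan_Suc insert_commute)
  have gaps: "\<theta> (Suc i) - \<theta> i \<in> {a, x, y, z}" if "i < 8" for i
  proof -
    have "\<forall>i\<in>{0, 1, 2, 3, 4, 5, 6, 7}. \<theta> (Suc i) - \<theta> i \<in> {a, x, y, z}"
      using gap_values by (simp add: eval_nat_numeral)
    then show ?thesis using that eight by blast
  qed
  have step: "\<theta> i \<le> \<theta> (Suc i) \<and> \<theta> (Suc i) \<le> \<theta> i + pi/2" if "i < 8" for i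
    using gaps[OF that] xyz a by auto
  have turn: "\<theta> 8 = \<theta> 0 + 2 * pi" unfolding \<theta> by (rule refl)
  have sum_gaps: "(\<Sum>i<8. f (\<theta> (Suc i) - \<theta> i)) = 2 * (f a + f x + f y + f z)" for f :: "real \<Rightarrow> real"
    unfolding eight using gap_values by (simp add: eval_nat_numeral)
  have S_compact: "compact S"
    using S(1,2) by (meson bounded_sphere bounded_subset compact_eq_bounded_closed)
  have "(\<Sum>i<8. sin (\<theta> (Suc i) - \<theta> i)) / 2 \<le> measure lborel (convex hull S)"
  proof (rule sum_sin_le_measure)
    have "(1/2) *\<^sub>R circle_point s + (1/2) *\<^sub>R (- circle_point s) \<in> convex hull S"
      using sa(1) S(3)[OF sa(1)] by (intro convexD convex_convex_hull) (auto intro: hull_inc)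
    then show "0 \<in> convex hull S" by simp
    show "\<theta> i \<le> \<theta> (Suc i) \<and> \<theta> (Suc i) < \<theta> i + pi" if "i < 8" for i
      using step[OF that] pi_gt_zero by linarith
  qed (use turn in_S S_compact in \<open>auto intro: hull_inc compact_convex_hull\<close>)
  then show "2 + e / 2 \<le> measure lborel (convex hull S)"
    using sum_sin_gaps_ge[OF e xyz] unfolding sum_gaps by simp
  have polar_eq: "{x. \<forall>u\<in>S. x \<bullet> u \<le> 1} = (\<Inter>u\<in>S. {x. u \<bullet> x \<le> 1})"
    by (auto simp: inner_commute)
  have "measure lborel {x. \<forall>u\<in>S. x \<bullet> u \<le> 1}
      \<le> (\<Sum>i<8. sin (\<theta> (Suc i) - \<theta> i) / (1 + cos (\<theta> (Suc i) - \<theta> i)))"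
  proof (rule measure_circumscribed_le[OF step turn])
    show "closed {x. \<forall>u\<in>S. x \<bullet> u \<le> 1}"
      unfolding polar_eq by (intro closed_INT ballI closed_halfspace_le)
  qed (use in_S in auto)
  then show "measure lborel {x. \<forall>u\<in>S. x \<bullet> u \<le> 1} \<le> 4 - 2 * e / 5"
    using sum_tan_half_gaps_le[OF e xyz] unfolding sum_gaps[of "\<lambda>g. sin g / (1 + cos g)"] by simp
qed

section \<open>The cross\<close>

text \<open>
  The square is the image of an axis-parallel one under an orthogonal map.
\<close>
lemma square_area:
  fixes w1 w2 :: "real^2"
  assumes w: "norm w1 = 1" "norm w2 = 1" "w1 \<bullet> w2 = 0" and c: "0 \<le> c"
  shows "{x. \<bar>x \<bullet> w1\<bar> \<le> c \<and> \<bar>x \<bullet> w2\<bar> \<le> c} \<in> fmeasurable lborel" (is "?Q \<in> _")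
    and "measure lborel {x. \<bar>x \<bullet> w1\<bar> \<le> c \<and> \<bar>x \<bullet> w2\<bar> \<le> c} = 4 * c\<^sup>2"
proof -
  obtain \<Phi> :: "real^2 \<Rightarrow> real^2"
    where \<Phi>: "orthogonal_transformation \<Phi>" "\<Phi> (axis 1 1) = w1"
    using orthogonal_transformation_exists[of "axis 1 1 :: real^2" w1] w(1) by auto
  obtain s where s: "w1 = circle_point s" using unit_vector_eq_circle_point[OF w(1)] by metis
  have "norm (\<Phi> (axis 2 1)) = 1" "circle_point s \<bullet> \<Phi> (axis 2 1) = 0"
    using \<Phi>(1) unfolding s[symmetric] \<Phi>(2)[symmetric]
    by (simp add: orthogonal_transformation_norm,
        simp add: orthogonal_transformation_def inner_axis_axis)
  then have "\<Phi> (axis 2 1) = circle_point (s + pi/2) \<or> \<Phi> (axis 2 1) = - circle_point (s + pi/2)"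
    by (rule unit_orthogonal_circle_point)
  moreover have "w2 = circle_point (s + pi/2) \<or> w2 = - circle_point (s + pi/2)"
    using w unfolding s by (intro unit_orthogonal_circle_point)
  ultimately have w2: "\<Phi> (axis 2 1) = w2 \<or> \<Phi> (axis 2 1) = - w2" by auto
  define B :: "(real^2) set" where "B = cbox (- vec c) (vec c)"
  have "\<Phi> x \<in> ?Q \<longleftrightarrow> x \<in> B" for x
  proof -
    have in1: "\<Phi> x \<bullet> w1 = x $ 1" and "\<Phi> x \<bullet> \<Phi> (axis 2 1) = x $ 2"
      using \<Phi>(1) unfolding \<Phi>(2)[symmetric] orthogonal_transformation_def
      by (simp_all add: inner_axis)
    then have "\<bar>\<Phi> x \<bullet> w2\<bar> = \<bar>x $ 2\<bar>" using w2 by auto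
    then show ?thesis
      using in1 unfolding B_def by (auto simp: mem_box_cart forall_2 abs_le_iff)
  qed
  moreover have "surj \<Phi>" using \<Phi>(1) by (rule orthogonal_transformation_surj)
  ultimately have Q: "?Q = \<Phi> ` B" by (auto simp: surj_def) (metis imageI)
  have "compact ?Q" unfolding Q B_def
    using \<Phi>(1) by (intro compact_continuous_image linear_continuous_on)
      (auto simp: orthogonal_transformation_linear linear_conv_bounded_linear[symmetric])
  then show meas: "?Q \<in> fmeasurable lborel" by (rule fmeasurable_compact)
  have "measure lborel ?Q = measure lebesgue ?Q"
    using meas by simp
  also have "\<dots> = measure lebesgue B"
    unfolding Q B_def by (rule measure_orthogonal_image[OF \<Phi>(1)]) simp
  also have "\<dots> = 4 * c\<^sup>2"
  proof -
    have "B \<noteq> {}" using c unfolding B_def by (simp add: interval_ne_empty_cart forall_2)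
    then show ?thesis
      unfolding B_def by (simp add: content_cbox_cart UNIV_2 power2_eq_square)
  qed
  finally show "measure lborel ?Q = 4 * c\<^sup>2" .
qed

text \<open>
  The polar body is the square of side \<open>2\<close>. The convex hull is the square of side \<open>\<surd>2\<close> with axes
  along the diagonals \<open>u1 + u2\<close> and \<open>u1 - u2\<close>.
\<close>
lemma cross_areas:
  assumes "cross_measure \<nu>"
  shows "measure lborel (Z_inf \<nu>) \<le> 2" and "measure lborel (Z_inf_polar \<nu>) = 4"
proof -
  obtain u1 u2 where u: "norm u1 = 1" "norm u2 = 1" "u1 \<bullet> u2 = 0"
    and supp: "supp \<nu> = {u1, - u1, u2, - u2}"
    using assms unfolding cross_measure_def by blast
  have uu: "u1 \<bullet> u1 = 1" "u2 \<bullet> u2 = 1" "u2 \<bullet> u1 = 0"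
    using u by (simp_all add: norm_eq_1 inner_commute)
  have "Z_inf_polar \<nu> = {x. \<bar>x \<bullet> u1\<bar> \<le> 1 \<and> \<bar>x \<bullet> u2\<bar> \<le> 1}"
    unfolding Z_inf_polar_def supp by (auto simp: abs_le_iff)
  then show "measure lborel (Z_inf_polar \<nu>) = 4"
    using square_area(2)[OF u, of 1] by simp
  define w1 w2 where "w1 = (1 / sqrt 2) *\<^sub>R (u1 + u2)" and "w2 = (1 / sqrt 2) *\<^sub>R (u1 - u2)"
  have w: "norm w1 = 1" "norm w2 = 1" "w1 \<bullet> w2 = 0"
    unfolding norm_eq_1 w1_def w2_def using uu u
    by (simp_all add: inner_add_left inner_add_right inner_diff_left inner_diff_right)
  let ?Q = "{x. \<bar>x \<bullet> w1\<bar> \<le> 1 / sqrt 2 \<and> \<bar>x \<bullet> w2\<bar> \<le> 1 / sqrt 2}"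
  have "?Q = {x. w1 \<bullet> x \<le> 1 / sqrt 2} \<inter> {x. w1 \<bullet> x \<ge> - (1 / sqrt 2)}
      \<inter> ({x. w2 \<bullet> x \<le> 1 / sqrt 2} \<inter> {x. w2 \<bullet> x \<ge> - (1 / sqrt 2)})"
    by (auto simp: abs_le_iff inner_commute)
  then have "convex ?Q"
    by (simp only:) (intro convex_Int convex_halfspace_le convex_halfspace_ge)
  moreover have "{u1, - u1, u2, - u2} \<subseteq> ?Q"
    unfolding w1_def w2_def using uu u by (auto simp: inner_add_right inner_diff_right)
  ultimately have sub: "Z_inf \<nu> \<subseteq> ?Q"
    unfolding Z_inf_def supp by (intro hull_minimal)
  have "compact (Z_inf \<nu>)" unfolding Z_inf_def supp by (intro compact_convex_hull) auto
  then have "measure lborel (Z_inf \<nu>) \<le> measure lborel ?Q"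
    using sub square_area(1)[OF w] by (intro measure_mono_fmeasurable) (auto intro: borel_compact)
  also have "\<dots> = 2" using square_area(2)[OF w, of "1 / sqrt 2"] by (simp add: power_divide)
  finally show "measure lborel (Z_inf \<nu>) \<le> 2" .
qed

section \<open>The stability estimate\<close>

theorem theorem11p1:
  fixes \<mu> \<nu>\<^sub>2 :: "(real^2) measure" and \<epsilon> :: real
  assumes "cross_measure \<nu>\<^sub>2"
    and "circle_measure \<mu>" and "even_measure \<mu>" and "isotropic \<mu>"
    and "0 < \<epsilon>" and "\<epsilon> < 1"
    and "spherical_hausdorff_O (supp \<mu>) (supp \<nu>\<^sub>2) \<ge> \<epsilon>"
  shows "measure lborel (Z_inf \<mu>) \<ge> (1 + 0.25 * \<epsilon>) * measure lborel (Z_inf \<nu>\<^sub>2) \<and>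
    measure lborel (Z_inf_polar \<mu>) \<le> (1 - 0.1 * \<epsilon>) * measure lborel (Z_inf_polar \<nu>\<^sub>2)"
proof -
  obtain u1 u2 where u: "norm u1 = 1" "norm u2 = 1" "u1 \<bullet> u2 = 0"
    and supp_\<nu>: "supp \<nu>\<^sub>2 = {u1, - u1, u2, - u2}"
    using assms(1) unfolding cross_measure_def by blast
  note S = supp_subset_sphere[OF assms(2)] supp_uminus[OF assms(2,3)]
  note gap = supp_next_point[OF assms(2,3,4)]
  \<comment> \<open>Working with \<open>e < \<epsilon>\<close> avoids having to show that the suprema in the Hausdorff distance
    are attained; letting \<open>e\<close> tend to \<open>\<epsilon>\<close> loses nothing.\<close>
  have bounds: "2 + e / 2 \<le> measure lborel (Z_inf \<mu>)
      \<and> measure lborel (Z_inf_polar \<mu>) \<le> 4 - 2 * e / 5" if e: "0 < e" "e < \<epsilon>" for e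
  proof -
    have "e \<le> pi" using e assms(6) pi_ge_two by linarith
    moreover have "e < spherical_hausdorff_O (supp \<mu>) {u1, - u1, u2, - u2}"
      using assms(7) e unfolding supp_\<nu> by simp
    ultimately have "\<exists>s a. e \<le> a \<and> a \<le> pi/2 - e \<and>
        circle_point s \<in> supp \<mu> \<and> circle_point (s + a) \<in> supp \<mu>"
      by (intro far_from_crosses[OF S gap u less_imp_le[OF e(1)]])
    then obtain s a where sa: "e \<le> a" "a \<le> pi/2 - e"
        "circle_point s \<in> supp \<mu>" "circle_point (s + a) \<in> supp \<mu>"
      by blast
    show ?thesis
      using area_estimates[OF closed_supp[OF assms(2)] S gap sa(3,4) _ sa(1,2)] e(1)
      unfolding Z_inf_def Z_inf_polar_def by simp
  qed
  have "\<epsilon> \<le> 2 * (measure lborel (Z_inf \<mu>) - 2)"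
    by (rule dense_le_bounded[OF assms(5)]) (use bounds in fastforce)
  moreover have "\<epsilon> \<le> 5 / 2 * (4 - measure lborel (Z_inf_polar \<mu>))"
    by (rule dense_le_bounded[OF assms(5)]) (use bounds in fastforce)
  moreover have "(1 + 0.25 * \<epsilon>) * measure lborel (Z_inf \<nu>\<^sub>2) \<le> (1 + 0.25 * \<epsilon>) * 2"
    using cross_areas(1)[OF assms(1)] assms(5) by (intro mult_left_mono) auto
  ultimately show ?thesis
    unfolding cross_areas(2)[OF assms(1)] by (simp add: algebra_simps)
qed

end
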